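(* Let $G$ be a connected (finite, simple) graph with forest number $\mathrm{f}(G)$. Then $\mathrm{rc}(G) \leq \mathrm{f}(G) + 2$.
   Context: For an edge-coloring of a graph $G$, a path is rainbow if no two of its edges have the same color; $G$ is rainbow-connected if every pair of vertices is joined by a rainbow path. The rainbow connection number $\mathrm{rc}(G)$ is the minimum number of colors in an edge-coloring making $G$ rainbow-connected. The forest number $\mathrm{f}(G)$ is the maximum number of vertices of an induced subgraph of $G$ that is a forest. *)

theory Defs
  imports Main
begin

definition simple_graph :: "'a set \<Rightarrow> 'a set set \<Rightarrow> bool" where
  "simple_graph V E \<longleftrightarrow> finite V \<and> (\<forall>e\<in>E. e \<subseteq> V \<and> card e = 2)"

definition path_edges :: "'a list \<Rightarrow> 'a set list" where
  "path_edges xs = map (\<lambda>i. {xs ! i, xs ! Suc i}) [0..<length xs - 1]"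

definition is_path :: "'a set \<Rightarrow> 'a set set \<Rightarrow> 'a list \<Rightarrow> 'a \<Rightarrow> 'a \<Rightarrow> bool" where
  "is_path V E xs u v \<longleftrightarrow> xs \<noteq> [] \<and> hd xs = u \<and> last xs = v \<and> distinct xs
     \<and> set xs \<subseteq> V \<and> set (path_edges xs) \<subseteq> E"

definition connected_graph :: "'a set \<Rightarrow> 'a set set \<Rightarrow> bool" where
  "connected_graph V E \<longleftrightarrow> simple_graph V E \<and> V \<noteq> {} \<and>
     (\<forall>u\<in>V. \<forall>v\<in>V. \<exists>xs. is_path V E xs u v)"

definition rainbow_path :: "('a set \<Rightarrow> 'c) \<Rightarrow> 'a list \<Rightarrow> bool" where
  "rainbow_path c xs \<longleftrightarrow> distinct (map c (path_edges xs))"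

definition rainbow_connected :: "'a set \<Rightarrow> 'a set set \<Rightarrow> ('a set \<Rightarrow> nat) \<Rightarrow> bool" where
  "rainbow_connected V E c \<longleftrightarrow>
     (\<forall>u\<in>V. \<forall>v\<in>V. \<exists>xs. is_path V E xs u v \<and> rainbow_path c xs)"

definition rc :: "'a set \<Rightarrow> 'a set set \<Rightarrow> nat" where
  "rc V E = (LEAST k. \<exists>c. (\<forall>e\<in>E. c e < k) \<and> rainbow_connected V E c)"

definition has_cycle :: "'a set \<Rightarrow> 'a set set \<Rightarrow> bool" where
  "has_cycle V E \<longleftrightarrow> (\<exists>xs. length xs \<ge> 3 \<and> distinct xs \<and> set xs \<subseteq> V
       \<and> set (path_edges xs) \<subseteq> E \<and> {last xs, hd xs} \<in> E)"

definition induced_edges :: "'a set set \<Rightarrow> 'a set \<Rightarrow> 'a set set" where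
  "induced_edges E S = {e\<in>E. e \<subseteq> S}"

definition induced_forest :: "'a set \<Rightarrow> 'a set set \<Rightarrow> 'a set \<Rightarrow> bool" where
  "induced_forest V E S \<longleftrightarrow> S \<subseteq> V \<and> \<not> has_cycle S (induced_edges E S)"

definition forest_number :: "'a set \<Rightarrow> 'a set set \<Rightarrow> nat" where
  "forest_number V E = Max {card S | S. induced_forest V E S}"

end

theory Submission
  imports Defs
begin

text \<open>A pendant vertex can be removed: putting it back costs one new colour and enlarges the
  induced forest by one vertex. So assume that all degrees are at least two.

  Grow a connected set \<open>D\<close> together with an induced forest \<open>S\<close>: as long as some vertex is not
  dominated by \<open>D\<close>, add to \<open>D\<close> a neighbour \<open>u\<close> of \<open>D\<close> that has an undominated neighbour \<open>v\<close>, and add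
  \<open>v\<close> to \<open>S\<close>. Taking \<open>u\<close> from \<open>S\<close> whenever possible keeps \<open>S\<close> a forest. This ends with a connected
  dominating set \<open>D\<close> with \<open>|S| = |D| + 1\<close>, and \<open>D\<close> is rainbow-connected by the \<open>|D| - 1\<close> edges of a
  spanning tree.

  Three more colours reach the vertices outside \<open>D\<close>. Let \<open>I\<close> be a maximal independent set outside
  \<open>D\<close>. Edges from \<open>I\<close> to \<open>D\<close> get colour A, other edges to \<open>D\<close> colour B, and edges outside \<open>D\<close>
  colour C. A vertex with neighbours outside \<open>D\<close> has one in the opposite class, through which a
  C-edge leads to the other colour; a vertex with all neighbours in \<open>D\<close> has at least two of them,
  and its edges can be given both colours A and B.\<close>

section \<open>Rainbow paths\<close>

lemma length_path_edges: "length (path_edges xs) = length xs - 1"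
  by (simp add: path_edges_def)

lemma nth_path_edges: "Suc i < length xs \<Longrightarrow> path_edges xs ! i = {xs ! i, xs ! Suc i}"
  by (simp add: path_edges_def less_diff_conv)

lemma path_edges_simps [simp]:
  "path_edges [] = []"
  "path_edges [x] = []"
  "path_edges (x # y # zs) = {x, y} # path_edges (y # zs)"
proof -
  show "path_edges (x # y # zs) = {x, y} # path_edges (y # zs)"
    by (rule nth_equalityI) (auto simp: length_path_edges nth_path_edges nth_Cons split: nat.split)
qed (simp_all add: path_edges_def)

lemma path_edges_Cons: "xs \<noteq> [] \<Longrightarrow> path_edges (x # xs) = {x, hd xs} # path_edges xs"
  by (cases xs) auto

lemma path_edges_rev: "path_edges (rev xs) = rev (path_edges xs)"
proof (rule nth_equalityI)
  fix i assume "i < length (path_edges (rev xs))"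
  then have i: "Suc i < length xs" by (simp add: length_path_edges)
  then have e: "Suc (length xs - Suc (Suc i)) = length xs - Suc i" by simp
  have "path_edges (rev xs) ! i = {xs ! (length xs - Suc i), xs ! (length xs - Suc (Suc i))}"
    using i by (simp add: nth_path_edges rev_nth)
  moreover have "rev (path_edges xs) ! i = path_edges xs ! (length xs - Suc (Suc i))"
    using i by (simp add: length_path_edges rev_nth)
  moreover have "\<dots> = {xs ! (length xs - Suc (Suc i)), xs ! (length xs - Suc i)}"
    using i e nth_path_edges[of "length xs - Suc (Suc i)" xs] by simp
  ultimately show "path_edges (rev xs) ! i = rev (path_edges xs) ! i"
    by (simp add: insert_commute)
qed (simp add: length_path_edges)

definition rpath :: "'a set \<Rightarrow> 'a set set \<Rightarrow> ('a set \<Rightarrow> nat) \<Rightarrow> 'a list \<Rightarrow> 'a \<Rightarrow> 'a \<Rightarrow> bool" where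
  "rpath V E c xs u v \<longleftrightarrow> is_path V E xs u v \<and> rainbow_path c xs"

lemma rainbow_connected_iff:
  "rainbow_connected V E c \<longleftrightarrow> (\<forall>u\<in>V. \<forall>v\<in>V. \<exists>xs. rpath V E c xs u v)"
  by (simp add: rainbow_connected_def rpath_def)

lemma rpath_singleton: "u \<in> V \<Longrightarrow> rpath V E c [u] u u"
  by (simp add: rpath_def is_path_def rainbow_path_def)

lemma rpath_Cons:
  assumes "rpath V E c xs u v" "w \<in> V" "w \<notin> set xs" "{w, u} \<in> E"
    and "c {w, u} \<notin> c ` set (path_edges xs)"
  shows "rpath V E c (w # xs) w v"
  using assms by (auto simp: rpath_def is_path_def rainbow_path_def path_edges_Cons)

lemma rpath_rev:
  assumes "rpath V E c xs u v"
  shows "rpath V E c (rev xs) v u"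
  using assms
  by (auto simp: rpath_def is_path_def rainbow_path_def path_edges_rev hd_rev last_rev
      simp flip: rev_map)

lemma rpath_mono:
  assumes "rpath V E c xs u v" "V \<subseteq> V'" "E \<subseteq> E'" "\<And>e. e \<in> E \<Longrightarrow> c' e = c e"
  shows "rpath V' E' c' xs u v"
proof -
  have "set (path_edges xs) \<subseteq> E" using assms(1) by (simp add: rpath_def is_path_def)
  then have "map c' (path_edges xs) = map c (path_edges xs)"
    using assms(4) by (intro map_cong) auto
  then show ?thesis using assms(1-3) unfolding rpath_def is_path_def rainbow_path_def
    by (simp only:) blast
qed

lemma rpath_sets:
  assumes "rpath V E c xs u v"
  shows "set xs \<subseteq> V" "set (path_edges xs) \<subseteq> E" "xs \<noteq> []" "hd xs = u" "last xs = v"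
  using assms by (auto simp: rpath_def is_path_def)

text \<open>The colour \<open>a\<close> of the attaching edge exceeds every colour on
  \<open>F\<close>, so prefixing \<open>{u, d}\<close> to a rainbow path from \<open>d\<close> keeps
  it rainbow. This serves both to grow the coloured tree on \<open>D\<close> and to put a pendant
  vertex back.\<close>

lemma rainbow_connected_insert:
  assumes rc: "rainbow_connected D F c" and d: "d \<in> D" and u: "u \<notin> D"
    and F: "\<forall>e\<in>F. e \<subseteq> D" and a: "\<forall>e\<in>F. c e < a"
  shows "rainbow_connected (insert u D) (insert {u, d} F) (c({u, d} := a))"
proof -
  let ?V = "insert u D" and ?E = "insert {u, d} F" and ?c = "c({u, d} := a)"
  have notF: "{u, d} \<notin> F" using F u by auto
  have old: "rpath ?V ?E ?c xs x y" if "rpath D F c xs x y" for xs x y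
    by (rule rpath_mono[OF that]) (use notF in auto)
  have new: "\<exists>xs. rpath ?V ?E ?c xs u y" if y: "y \<in> D" for y
  proof -
    obtain xs where xs: "rpath D F c xs d y"
      using rc d y unfolding rainbow_connected_iff by blast
    note s = rpath_sets[OF xs]
    have "rpath ?V ?E ?c (u # xs) u y"
    proof (rule rpath_Cons[OF old[OF xs]])
      show "?c {u, d} \<notin> ?c ` set (path_edges xs)"
      proof -
        have "?c e < a" if "e \<in> set (path_edges xs)" for e
          using that s(2) a notF by auto
        then show ?thesis by fastforce
      qed
    qed (use s u in auto)
    then show ?thesis by blast
  qed
  show ?thesis
    unfolding rainbow_connected_iff
  proof (intro ballI)
    fix x y assume "x \<in> ?V" "y \<in> ?V"
    then consider "x = u" "y = u" | "x = u" "y \<in> D" | "x \<in> D" "y = u" | "x \<in> D" "y \<in> D" by auto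
    then show "\<exists>xs. rpath ?V ?E ?c xs x y"
    proof cases
      case 1 then show ?thesis using rpath_singleton[of u ?V] by blast
    next
      case 2 then show ?thesis using new by blast
    next
      case 3 then show ?thesis using new[of x] by (metis rpath_rev)
    next
      case 4 then show ?thesis using rc old unfolding rainbow_connected_iff by blast
    qed
  qed
qed

section \<open>Induced forests\<close>

text \<open>A cycle through \<open>v\<close> would give it two distinct neighbours in
  \<open>S\<close>, against \<open>uniq\<close>; any other cycle lies in \<open>S\<close>.\<close>

lemma induced_forest_insert:
  assumes S: "induced_forest V E S" and v: "v \<in> V"
    and E: "\<forall>e\<in>E. card e = 2"
    and uniq: "\<And>a b. \<lbrakk>a \<in> S; b \<in> S; {v, a} \<in> E; {v, b} \<in> E\<rbrakk> \<Longrightarrow> a = b"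
  shows "induced_forest V E (insert v S)"
proof -
  have "\<not> has_cycle (insert v S) (induced_edges E (insert v S))"
  proof
    assume "has_cycle (insert v S) (induced_edges E (insert v S))"
    then obtain xs where xs: "length xs \<ge> 3" "distinct xs" "set xs \<subseteq> insert v S"
      "set (path_edges xs) \<subseteq> E" "{last xs, hd xs} \<in> E"
      unfolding has_cycle_def induced_edges_def by fast
    let ?n = "length xs"
    have cyc: "{xs ! i, xs ! (Suc i mod ?n)} \<in> E" if "i < ?n" for i
    proof (cases "Suc i = ?n")
      case True
      moreover have "xs \<noteq> []" using xs(1) by auto
      ultimately have "xs ! i = last xs" "xs ! 0 = hd xs"
        by (simp_all add: last_conv_nth hd_conv_nth flip: True)
      then show ?thesis using xs(5) True by simp
    next
      case False
      then have "Suc i < ?n" using that by simp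
      then show ?thesis using xs(4) by (auto simp: path_edges_def)
    qed
    show False
    proof (cases "v \<in> set xs")
      case True
      then obtain i where i: "i < ?n" "xs ! i = v" by (auto simp: in_set_conv_nth)
      \<comment> \<open>\<open>j\<close> and \<open>k\<close> are the cyclic successor and
        predecessor of \<open>i\<close>; they differ because the cycle has at least three
        vertices.\<close>
      define j where "j = Suc i mod ?n"
      define k where "k = (if i = 0 then ?n - 1 else i - 1)"
      have k: "k < ?n" "Suc k mod ?n = i" using i xs(1) by (auto simp: k_def)
      have j: "j < ?n" using xs(1) by (auto simp: j_def intro: mod_less_divisor)
      have "j \<noteq> k" "j \<noteq> i" "k \<noteq> i"
        using i xs(1) by (auto simp: j_def k_def mod_Suc)
      then have ne: "xs ! j \<noteq> xs ! k" "xs ! j \<noteq> v" "xs ! k \<noteq> v"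
        using xs(2) i j k nth_eq_iff_index_eq by metis+
      have "{v, xs ! j} \<in> E" using cyc[OF i(1)] i(2) by (simp add: j_def)
      moreover have "{v, xs ! k} \<in> E" using cyc[OF k(1)] i(2) k(2) by (simp add: insert_commute)
      moreover have "xs ! j \<in> S" "xs ! k \<in> S" using xs(3) j k(1) ne by (auto dest: nth_mem)
      ultimately show False using uniq ne by blast
    next
      case False
      then have sub: "set xs \<subseteq> S" using xs(3) by auto
      have "e \<subseteq> set xs" if "e \<in> set (path_edges xs)" for e
        using that by (auto simp: path_edges_def)
      moreover have "{last xs, hd xs} \<subseteq> set xs" using xs(1) by (cases xs) auto
      ultimately have "has_cycle S (induced_edges E S)"
        unfolding has_cycle_def induced_edges_def using xs sub by blast
      then show False using S by (simp add: induced_forest_def)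
    qed
  qed
  then show ?thesis using S v by (auto simp: induced_forest_def)
qed

lemma induced_forest_empty: "induced_forest V E {}"
  by (auto simp: induced_forest_def has_cycle_def)

section \<open>Connectivity by cuts\<close>

text \<open>Growing \<open>D\<close> and deleting a pendant vertex both ask for an edge across a
  cut, never for a path, so connectedness is kept in this form.\<close>

definition cut_connected :: "'a set \<Rightarrow> 'a set set \<Rightarrow> bool" where
  "cut_connected V E \<longleftrightarrow> V \<noteq> {} \<and>
     (\<forall>A. A \<subseteq> V \<and> A \<noteq> {} \<and> A \<noteq> V \<longrightarrow> (\<exists>u\<in>A. \<exists>v\<in>V - A. {u, v} \<in> E))"

lemma cut_connectedD:
  assumes "cut_connected V E" "A \<subseteq> V" "A \<noteq> {}" "A \<noteq> V"
  obtains u v where "u \<in> A" "v \<in> V - A" "{u, v} \<in> E"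
  using assms unfolding cut_connected_def by blast

lemma path_crosses_cut:
  assumes "xs \<noteq> []" "hd xs \<in> A" "last xs \<notin> A" "set xs \<subseteq> V" "set (path_edges xs) \<subseteq> E"
  shows "\<exists>u\<in>A. \<exists>v\<in>V - A. {u, v} \<in> E"
  using assms
proof (induction xs rule: induct_list012)
  case (3 x y zs)
  then show ?case by (cases "y \<in> A") auto
qed auto

lemma connected_graph_imp_cut_connected:
  assumes "connected_graph V E"
  shows "cut_connected V E"
  unfolding cut_connected_def
proof (intro conjI allI impI)
  show "V \<noteq> {}" using assms by (simp add: connected_graph_def)
  fix A assume A: "A \<subseteq> V \<and> A \<noteq> {} \<and> A \<noteq> V"
  then obtain x y where xy: "x \<in> A" "y \<in> V - A" by blast
  then obtain xs where "is_path V E xs x y"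
    using assms A unfolding connected_graph_def by blast
  then show "\<exists>u\<in>A. \<exists>v\<in>V - A. {u, v} \<in> E"
    using path_crosses_cut[of xs A V E] xy by (auto simp: is_path_def)
qed

section \<open>A connected dominating set smaller than an induced forest\<close>

definition closed_nbh :: "'a set \<Rightarrow> 'a set set \<Rightarrow> 'a set \<Rightarrow> 'a set" where
  "closed_nbh V E D = D \<union> {v\<in>V. \<exists>d\<in>D. {v, d} \<in> E}"

lemma closed_nbh_insert: "closed_nbh V E (insert u D) =
   insert u (closed_nbh V E D) \<union> {v\<in>V. {v, u} \<in> E}"
  by (auto simp: closed_nbh_def)

text \<open>A vertex of the forest \<open>S\<close> outside \<open>D\<close> is live if it has a neighbour not yet dominated by
  \<open>D\<close>. As there is at most one live vertex, an undominated vertex has at most one neighbour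
  in \<open>S\<close>, and so can always be added to the forest.\<close>

definition live :: "'a set \<Rightarrow> 'a set set \<Rightarrow> 'a set \<Rightarrow> 'a \<Rightarrow> bool" where
  "live V E D w \<longleftrightarrow> (\<exists>y\<in>V - closed_nbh V E D. {w, y} \<in> E)"

text \<open>\<open>F\<close> and \<open>c\<close> are the edges and colours of the tree grown on
  \<open>D\<close>. The bound \<open>c e + 1 < card D\<close> allows \<open>card D - 1\<close>
  colours without truncated subtraction. Uniqueness of the live vertex is the invariant that keeps
  \<open>S\<close> a forest.\<close>

definition greedy_state ::
  "'a set \<Rightarrow> 'a set set \<Rightarrow> 'a set \<Rightarrow> 'a set \<Rightarrow> 'a set set \<Rightarrow> ('a set \<Rightarrow> nat) \<Rightarrow> bool" where
  "greedy_state V E D S F c \<longleftrightarrow> D \<subseteq> V \<and> D \<noteq> {} \<and> S \<subseteq> closed_nbh V E D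
     \<and> induced_forest V E S \<and> card S = card D + 1
     \<and> (\<forall>w\<in>S - D. \<forall>w'\<in>S - D. live V E D w \<longrightarrow> live V E D w' \<longrightarrow> w = w')
     \<and> F \<subseteq> E \<and> (\<forall>e\<in>F. e \<subseteq> D \<and> c e + 1 < card D) \<and> rainbow_connected D F c"

text \<open>Choosing \<open>u\<close> to be the live vertex of \<open>S\<close>, if there is one,
  absorbs it into \<open>D\<close>; afterwards only the new forest vertex \<open>v\<close> can be
  live, so the invariant is restored.\<close>

lemma greedy_state_extend:
  assumes G: "simple_graph V E" and con: "cut_connected V E"
    and st: "greedy_state V E D S F c" and nd: "closed_nbh V E D \<noteq> V"
  shows "\<exists>D' S' F' c'. greedy_state V E D' S' F' c' \<and> card D' = card D + 1"
proof -
  let ?N = "closed_nbh V E D"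
  have D: "D \<subseteq> V" "D \<noteq> {}" and SN: "S \<subseteq> ?N" and fo: "induced_forest V E S"
    and cS: "card S = card D + 1"
    and lv: "\<And>w w'. \<lbrakk>w \<in> S - D; w' \<in> S - D; live V E D w; live V E D w'\<rbrakk> \<Longrightarrow> w = w'"
    and F: "F \<subseteq> E" "\<forall>e\<in>F. e \<subseteq> D \<and> c e + 1 < card D" and rc: "rainbow_connected D F c"
    using st unfolding greedy_state_def by blast+
  have fin: "finite V" and E2: "\<forall>e\<in>E. card e = 2" using G by (auto simp: simple_graph_def)
  have finD: "finite D" and NV: "?N \<subseteq> V" and DN: "D \<subseteq> ?N"
    using D fin by (auto simp: closed_nbh_def dest: finite_subset)
  have finS: "finite S" using SN NV fin by (meson finite_subset)
  have "\<exists>u v. u \<in> ?N \<and> v \<in> V - ?N \<and> {u, v} \<in> E \<and>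
      (\<forall>w\<in>S - D. live V E D w \<longrightarrow> w = u)"
  proof (cases "\<exists>w\<in>S - D. live V E D w")
    case True
    then obtain w where w: "w \<in> S - D" "live V E D w" by blast
    then obtain v where "v \<in> V - ?N" "{w, v} \<in> E" by (auto simp: live_def)
    then show ?thesis using w lv SN by blast
  next
    case False
    have "?N \<noteq> {}" using DN D by auto
    from cut_connectedD[OF con NV this nd] False show ?thesis by metis
  qed
  then obtain u v where u: "u \<in> ?N" and v: "v \<in> V - ?N" and uv: "{u, v} \<in> E"
    and only: "\<And>w. \<lbrakk>w \<in> S - D; live V E D w\<rbrakk> \<Longrightarrow> w = u" by blast
  have uD: "u \<notin> D" using v uv by (auto simp: closed_nbh_def insert_commute)
  then obtain d where d: "d \<in> D" "{u, d} \<in> E" using u by (auto simp: closed_nbh_def)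
  have uV: "u \<in> V" using u NV by auto
  have vS: "v \<notin> S" using v SN by auto
  \<comment> \<open>Colours on \<open>F\<close> are below \<open>card D - 1\<close>, so this colour
    is new and still fits the bound for \<open>?D\<close>.\<close>
  let ?D = "insert u D" and ?S = "insert v S" and ?F = "insert {u, d} F"
    and ?c = "c({u, d} := card D - 1)"
  \<comment> \<open>Enlarging \<open>D\<close> dominates more vertices, so liveness can only be
    lost.\<close>
  have mono: "live V E D w" if "live V E ?D w" for w
    using that by (auto simp: live_def closed_nbh_insert)
  \<comment> \<open>Since \<open>v\<close> is undominated, its neighbours in \<open>S\<close> lie
    outside \<open>D\<close> and are live.\<close>
  have nbr: "a = u" if "a \<in> S" "{v, a} \<in> E" for a
  proof (rule only)
    show "a \<in> S - D" using that v by (auto simp: closed_nbh_def)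
    show "live V E D a" using that v by (auto simp: live_def insert_commute)
  qed
  have "greedy_state V E ?D ?S ?F ?c"
    unfolding greedy_state_def
  proof (intro conjI)
    show "?S \<subseteq> closed_nbh V E ?D"
      using SN v uv by (auto simp: closed_nbh_insert insert_commute)
    show "induced_forest V E ?S"
      by (rule induced_forest_insert[OF fo _ E2]) (use v nbr in auto)
    show "card ?S = card ?D + 1" using cS uD vS finD finS by simp
    show "\<forall>w\<in>?S - ?D. \<forall>w'\<in>?S - ?D. live V E ?D w \<longrightarrow> live V E ?D w' \<longrightarrow> w = w'"
      using only mono by blast
    have cD: "card D > 0" using finD D by (simp add: card_gt_0_iff)
    show "\<forall>e\<in>?F. e \<subseteq> ?D \<and> ?c e + 1 < card ?D"
      using F(2) d uD finD cD by auto
    show "rainbow_connected ?D ?F ?c"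
      by (rule rainbow_connected_insert[OF rc d(1) uD]) (use F(2) in auto)
  qed (use D uV F d in auto)
  moreover have "card ?D = card D + 1" using uD finD by simp
  ultimately show ?thesis by blast
qed

lemma greedy_state_init:
  assumes G: "simple_graph V E" and con: "cut_connected V E" and c2: "card V \<ge> 2"
  shows "\<exists>D S F c. greedy_state V E D S F c"
proof -
  obtain x where x: "x \<in> V" using con by (auto simp: cut_connected_def)
  have "{x} \<noteq> V" using c2 by auto
  then obtain y where y: "y \<in> V" "y \<noteq> x" "{x, y} \<in> E"
    using cut_connectedD[OF con, of "{x}"] x by auto
  have E2: "\<forall>e\<in>E. card e = 2" using G by (auto simp: simple_graph_def)
  have "induced_forest V E {x}"
    by (rule induced_forest_insert[OF induced_forest_empty x E2]) auto
  then have fo: "induced_forest V E {y, x}"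
    by (rule induced_forest_insert[OF _ y(1) E2]) auto
  \<comment> \<open>Only \<open>y\<close> lies in \<open>S - D\<close>, so uniqueness of the live
    vertex is trivial, and no edge needs a colour yet.\<close>
  have "greedy_state V E {x} {y, x} {} (\<lambda>_. 0)"
    unfolding greedy_state_def
    using fo x y rpath_singleton[of x "{x}"]
    by (auto simp: closed_nbh_def insert_commute rainbow_connected_iff)
  then show ?thesis by blast
qed

text \<open>A state with \<open>card D\<close> largest is dominating, since otherwise it could be
  extended; the sizes are bounded by \<open>card V\<close>.\<close>

lemma ex_dominating_greedy_state:
  assumes G: "simple_graph V E" and con: "cut_connected V E" and c2: "card V \<ge> 2"
  shows "\<exists>D S F c. greedy_state V E D S F c \<and> closed_nbh V E D = V"
proof -
  let ?P = "\<lambda>D. \<exists>S F c. greedy_state V E D S F c"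
  obtain D0 where D0: "?P D0" using greedy_state_init[OF assms] by blast
  have fin: "finite V" using G by (simp add: simple_graph_def)
  have "\<forall>D. ?P D \<longrightarrow> card D < Suc (card V)"
    using fin by (auto simp: greedy_state_def less_Suc_eq_le intro: card_mono)
  then obtain D where D: "?P D" and max: "\<And>D'. ?P D' \<Longrightarrow> card D' \<le> card D"
    using ex_has_greatest_nat[of ?P D0 card] D0 by metis
  then obtain S F c where st: "greedy_state V E D S F c" by blast
  have "closed_nbh V E D = V"
  proof (rule ccontr)
    assume "closed_nbh V E D \<noteq> V"
    then obtain D' where "?P D'" "card D' = card D + 1"
      using greedy_state_extend[OF G con st] by blast
    then show False using max[of D'] by simp
  qed
  then show ?thesis using st by blast
qed

section \<open>Colouring around a dominating set\<close>

text \<open>Vertices are tried one at a time and kept if they have no neighbour in the set so far; a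
  rejected vertex keeps its neighbour as the set grows.\<close>

lemma ex_maximal_independent_set:
  assumes "finite W"
  shows "\<exists>I\<subseteq>W. (\<forall>x\<in>I. \<forall>y\<in>I. x \<noteq> y \<longrightarrow> {x, y} \<notin> E) \<and> (\<forall>x\<in>W - I. \<exists>y\<in>I. {x, y} \<in> E)"
  using assms
proof induction
  case (insert w W)
  then obtain I where I: "I \<subseteq> W" "\<forall>x\<in>I. \<forall>y\<in>I. x \<noteq> y \<longrightarrow> {x, y} \<notin> E"
    "\<forall>x\<in>W - I. \<exists>y\<in>I. {x, y} \<in> E" by blast
  show ?case
  proof (cases "\<exists>y\<in>I. {w, y} \<in> E")
    case True
    then show ?thesis using I by (intro exI[of _ I]) auto
  next
    case False
    then show ?thesis using I
      by (intro exI[of _ "insert w I"]) (auto simp: insert_commute)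
  qed
qed auto

lemma rainbow_connected_dominating:
  assumes G: "simple_graph V E" and D: "D \<subseteq> V" and dom: "closed_nbh V E D = V"
    and F: "F \<subseteq> E" "\<forall>e\<in>F. e \<subseteq> D \<and> c e < m" and rc: "rainbow_connected D F c"
    and deg: "\<And>v. v \<in> V \<Longrightarrow> \<exists>a b. a \<noteq> b \<and> {v, a} \<in> E \<and> {v, b} \<in> E"
  shows "\<exists>c'. (\<forall>e\<in>E. c' e < m + 3) \<and> rainbow_connected V E c'"
proof -
  have fin: "finite V" and E2: "\<And>e. e \<in> E \<Longrightarrow> e \<subseteq> V \<and> card e = 2"
    using G by (auto simp: simple_graph_def)
  define W where "W = V - D"
  have "finite W" using fin by (simp add: W_def)
  then obtain I where I: "I \<subseteq> W" "\<And>x y. \<lbrakk>x \<in> I; y \<in> I; x \<noteq> y\<rbrakk> \<Longrightarrow> {x, y} \<notin> E"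
    "\<And>x. x \<in> W - I \<Longrightarrow> \<exists>y\<in>I. {x, y} \<in> E"
    using ex_maximal_independent_set[of W E] by metis
  define iso where "iso v \<longleftrightarrow> (\<forall>w\<in>W. {v, w} \<notin> E)" for v
  have "\<forall>v\<in>W. \<exists>d\<in>D. {v, d} \<in> E" using dom by (auto simp: W_def closed_nbh_def)
  then obtain p where p: "\<And>v. v \<in> W \<Longrightarrow> p v \<in> D \<and> {v, p v} \<in> E" by metis
  \<comment> \<open>A vertex of \<open>I\<close> without neighbours outside \<open>D\<close> uses
    \<open>m\<close> only on its edge to \<open>p v\<close>, so its other edges receive
    \<open>m + 1\<close>.\<close>
  define isA where "isA e \<longleftrightarrow> (\<exists>v\<in>I. \<exists>d\<in>D. e = {v, d} \<and> (iso v \<longrightarrow> d = p v))" for e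
  define c' where "c' e = (if e \<in> F then c e else if e \<subseteq> W then m + 2
      else if isA e then m else m + 1)" for e
  have bound: "\<forall>e\<in>E. c' e < m + 3" using F(2) by (auto simp: c'_def)

  have c'_F: "c' e = c e" "c' e < m" if "e \<in> F" for e using that F(2) by (auto simp: c'_def)
  have c'_W: "c' {v, w} = m + 2" if "v \<in> W" "w \<in> W" for v w
    using that F(2) by (auto simp: c'_def W_def)
  have c'_out: "c' {v, d} = (if v \<in> I \<and> (iso v \<longrightarrow> d = p v) then m else m + 1)"
    if "v \<in> W" "d \<in> D" for v d
  proof -
    have "{v, d} \<notin> F" "d \<notin> W" using that F(2) by (auto simp: W_def)
    moreover have "isA {v, d} \<longleftrightarrow> v \<in> I \<and> (iso v \<longrightarrow> d = p v)"
      unfolding isA_def using that I(1) by (auto simp: W_def doubleton_eq_iff)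
    ultimately show ?thesis by (simp add: c'_def)
  qed

  define exits where "exits v a \<longleftrightarrow> v \<in> W \<and> (\<exists>d\<in>D. {v, d} \<in> E \<and> c' {v, d} = a)" for v a
  have exits_I: "exits v m" if "v \<in> I" for v
    unfolding exits_def using p[of v] that I(1) c'_out[of v "p v"] by auto
  have exits_notI: "exits v (m + 1)" if "v \<in> W - I" for v
    unfolding exits_def using p[of v] that c'_out[of v "p v"] by auto
  have exits_iso: "exits v (m + 1)" if v: "v \<in> I" "iso v" for v
  proof -
    have vW: "v \<in> W" using v I(1) by auto
    then have "v \<in> V" by (simp add: W_def)
    then obtain d where d: "d \<noteq> p v" "{v, d} \<in> E" using deg[of v] by metis
    then have "d \<in> D" using E2[of "{v, d}"] v(2) by (auto simp: iso_def W_def)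
    then show ?thesis unfolding exits_def using d v vW c'_out[of v d] by auto
  qed
  \<comment> \<open>A neighbour in \<open>W\<close> is outside \<open>I\<close> by
    independence.\<close>
  have I_nbr: "\<exists>w\<in>W - I. {v, w} \<in> E" if v: "v \<in> I" "\<not> iso v" for v
  proof -
    obtain w where w: "w \<in> W" "{v, w} \<in> E" using v by (auto simp: iso_def)
    then have "v \<noteq> w" using E2[of "{v, w}"] by auto
    then show ?thesis using w I(2) v by blast
  qed

  have inner: "\<exists>xs. rpath V E c' xs x y \<and> set xs \<subseteq> D \<and> c' ` set (path_edges xs) \<subseteq> {..<m}"
    if xy: "x \<in> D" "y \<in> D" for x y
  proof -
    obtain xs where xs: "rpath D F c xs x y" using rc xy unfolding rainbow_connected_iff by blast
    have "rpath V E c' xs x y" by (rule rpath_mono[OF xs D F(1)]) (use c'_F in auto)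
    then show ?thesis using rpath_sets(1,2)[OF xs] c'_F(2) by blast
  qed
  \<comment> \<open>The condition on \<open>a\<close> keeps the first edge apart from the colours
    below \<open>m\<close> used inside \<open>D\<close>.\<close>
  have half: "\<exists>xs. rpath V E c' xs u y \<and> set xs \<subseteq> insert u D
      \<and> c' ` set (path_edges xs) \<subseteq> insert a {..<m}"
    if u: "exits u a" and a: "a \<ge> m" and y: "y \<in> D" for u a y
  proof -
    obtain d where d: "d \<in> D" "{u, d} \<in> E" "c' {u, d} = a" and uW: "u \<in> W"
      using u by (auto simp: exits_def)
    obtain xs where xs: "rpath V E c' xs d y" "set xs \<subseteq> D" "c' ` set (path_edges xs) \<subseteq> {..<m}"
      using inner[OF d(1) y] by blast
    have "rpath V E c' (u # xs) u y"
      by (rule rpath_Cons[OF xs(1)]) (use d uW xs a in \<open>auto simp: W_def\<close>)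
    moreover have "path_edges (u # xs) = {u, d} # path_edges xs"
      using rpath_sets[OF xs(1)] by (simp add: path_edges_Cons)
    ultimately show ?thesis using xs d by (intro exI[of _ "u # xs"]) auto
  qed
  \<comment> \<open>The path enters \<open>D\<close> by colour \<open>a\<close> and leaves it by
    \<open>b\<close>; these differ, and neither occurs inside \<open>D\<close>.\<close>
  have through: "\<exists>xs. rpath V E c' xs u v \<and> set xs \<subseteq> {u, v} \<union> D
      \<and> c' ` set (path_edges xs) \<subseteq> {..<m + 2}"
    if u: "exits u a" and v: "exits v b" and uv: "u \<noteq> v"
      and ab: "a \<noteq> b" "a \<in> {m, m + 1}" "b \<in> {m, m + 1}"
    for u v a b
  proof -
    obtain d where d: "d \<in> D" "{u, d} \<in> E" "c' {u, d} = a" and uW: "u \<in> W"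
      using u by (auto simp: exits_def)
    obtain xs where xs: "rpath V E c' xs v d" "set xs \<subseteq> insert v D"
      "c' ` set (path_edges xs) \<subseteq> insert b {..<m}"
      using half[OF v _ d(1)] ab by auto
    have xs': "rpath V E c' (rev xs) d v" by (rule rpath_rev[OF xs(1)])
    have "rpath V E c' (u # rev xs) u v"
      by (rule rpath_Cons[OF xs'])
        (use d uW xs(2,3) ab uv in \<open>auto simp: W_def path_edges_rev\<close>)
    moreover have "path_edges (u # rev xs) = {u, d} # rev (path_edges xs)"
      using rpath_sets[OF xs'] by (simp add: path_edges_Cons path_edges_rev)
    ultimately show ?thesis using xs d ab by (intro exI[of _ "u # rev xs"]) fastforce
  qed
  \<comment> \<open>The first edge lies in \<open>W\<close> and has colour \<open>m + 2\<close>,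
    which \<open>through\<close> avoids.\<close>
  have detour: "\<exists>xs. rpath V E c' xs u v"
    if u: "u \<in> W" "{u, w} \<in> E" and w: "exits w a" and v: "exits v b"
      and ne: "w \<noteq> v" "u \<noteq> v" and ab: "a \<noteq> b" "a \<in> {m, m + 1}" "b \<in> {m, m + 1}"
    for u v w a b
  proof -
    obtain xs where xs: "rpath V E c' xs w v" "set xs \<subseteq> {w, v} \<union> D"
      "c' ` set (path_edges xs) \<subseteq> {..<m + 2}"
      using through[OF w v ne(1) ab] by blast
    have wW: "w \<in> W" using w by (simp add: exits_def)
    have "u \<noteq> w" using E2[OF u(2)] by auto
    then have "rpath V E c' (u # xs) u v"
      by (intro rpath_Cons[OF xs(1)]) (use u wW xs ne c'_W[of u w] in \<open>auto simp: W_def\<close>)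
    then show ?thesis by blast
  qed
  \<comment> \<open>Vertices of opposite classes leave by different colours. Within one class, a
    first step into the other class achieves this, except that for \<open>u\<close> in
    \<open>I\<close> with \<open>iso u\<close> the colour \<open>m + 1\<close> is available
    directly.\<close>
  have outer: "\<exists>xs. rpath V E c' xs u v" if u: "u \<in> W" and v: "v \<in> W" and ne: "u \<noteq> v" for u v
  proof (cases "u \<in> I")
    case uI: True
    show ?thesis
    proof (cases "v \<in> I")
      case vI: True
      show ?thesis
      proof (cases "iso u")
        case True
        then show ?thesis using through[OF exits_iso exits_I, of u v] uI vI ne by auto
      next
        case False
        then obtain w where "w \<in> W - I" "{u, w} \<in> E" using I_nbr uI by blast
        then show ?thesis using detour[OF u _ exits_notI exits_I, of w v] vI ne by auto
      qed
    next
      case False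
      then show ?thesis using through[OF exits_I exits_notI, of u v] uI v ne by auto
    qed
  next
    case uI: False
    show ?thesis
    proof (cases "v \<in> I")
      case True
      then show ?thesis using through[OF exits_notI exits_I, of u v] uI u ne by auto
    next
      case False
      obtain w where "w \<in> I" "{u, w} \<in> E" using I(3)[of u] uI u by blast
      then show ?thesis using detour[OF u _ exits_I exits_notI, of w v] False v ne by auto
    qed
  qed
  have W_D: "\<exists>xs. rpath V E c' xs u y" if u: "u \<in> W" and y: "y \<in> D" for u y
  proof -
    have "exits u m \<or> exits u (m + 1)" using exits_I exits_notI u by blast
    then show ?thesis using half[of u m y] half[of u "m + 1" y] y by auto
  qed
  have "rainbow_connected V E c'"
    unfolding rainbow_connected_iff
  proof (intro ballI)
    fix x y assume xy: "x \<in> V" "y \<in> V"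
    consider "x = y" | "x \<in> D" "y \<in> D" | "x \<in> W" "y \<in> D" | "x \<in> D" "y \<in> W"
      | "x \<in> W" "y \<in> W" "x \<noteq> y" using xy unfolding W_def by auto
    then show "\<exists>xs. rpath V E c' xs x y"
    proof cases
      case 1 then show ?thesis using rpath_singleton[of x V E c'] xy by auto
    next
      case 2 then show ?thesis using inner by blast
    next
      case 3 then show ?thesis using W_D by blast
    next
      case 4 then show ?thesis using W_D[of y x] by (metis rpath_rev)
    next
      case 5 then show ?thesis using outer by blast
    qed
  qed
  with bound show ?thesis by blast
qed

section \<open>Pendant vertices\<close>

text \<open>Given a cut of the smaller graph, \<open>x\<close> is put on the side of
  \<open>y\<close>; its only possible edge then does not cross, so the crossing edge survives the
  deletion.\<close>

lemma cut_connected_remove_pendant: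
  assumes con: "cut_connected V E" and y: "y \<in> V" "y \<noteq> x"
    and pend: "\<And>a. {x, a} \<in> E \<Longrightarrow> a = y"
  shows "cut_connected (V - {x}) {e\<in>E. x \<notin> e}"
  unfolding cut_connected_def
proof (intro conjI allI impI)
  show "V - {x} \<noteq> {}" using y by blast
  fix A assume A: "A \<subseteq> V - {x} \<and> A \<noteq> {} \<and> A \<noteq> V - {x}"
  have "\<exists>u\<in>A. \<exists>v\<in>V - {x} - A. {u, v} \<in> E"
  proof (cases "x \<in> V \<and> y \<in> A")
    case True
    have "insert x A \<subseteq> V" "insert x A \<noteq> {}" "insert x A \<noteq> V" using A True by auto
    then obtain u v where uv: "u \<in> insert x A" "v \<in> V - insert x A" "{u, v} \<in> E"
      by (rule cut_connectedD[OF con])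
    then have "u \<noteq> x" using pend True by auto
    then show ?thesis using uv by blast
  next
    case False
    have "A \<subseteq> V" "A \<noteq> {}" "A \<noteq> V" using A y False by auto
    then obtain u v where uv: "u \<in> A" "v \<in> V - A" "{u, v} \<in> E"
      by (rule cut_connectedD[OF con])
    then have "v \<noteq> x" using pend[of u] False by (auto simp: insert_commute)
    then show ?thesis using uv by blast
  qed
  then show "\<exists>u\<in>A. \<exists>v\<in>V - {x} - A. {u, v} \<in> {e\<in>E. x \<notin> e}" using A by fastforce
qed

text \<open>The forest \<open>S\<close> is carried along explicitly, so that restoring a pendant
  vertex enlarges it by one along with the number of colours. Once all degrees are at least two, the
  dominating set takes over.\<close>

lemma ex_forest_colouring:
  assumes "simple_graph V E" "cut_connected V E"
  shows "\<exists>S c. induced_forest V E S \<and> (\<forall>e\<in>E. c e < card S + 1) \<and> rainbow_connected V E c"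
  using assms
proof (induction "card V" arbitrary: V E rule: less_induct)
  case less
  note G = less.prems(1) and con = less.prems(2)
  have fin: "finite V" and E2: "\<And>e. e \<in> E \<Longrightarrow> e \<subseteq> V \<and> card e = 2"
    using G by (auto simp: simple_graph_def)
  have V0: "V \<noteq> {}" using con by (simp add: cut_connected_def)
  consider "card V = 1" | x where "card V \<ge> 2" "x \<in> V" "\<And>a b. \<lbrakk>{x, a} \<in> E; {x, b} \<in> E\<rbrakk> \<Longrightarrow> a = b"
    | "card V \<ge> 2" "\<And>v. v \<in> V \<Longrightarrow> \<exists>a b. a \<noteq> b \<and> {v, a} \<in> E \<and> {v, b} \<in> E"
  proof -
    have "card V \<noteq> 0" using fin V0 by simp
    then have "card V = 1 \<or> card V \<ge> 2" by linarith
    then show thesis using that by blast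
  qed
  then show ?case
  proof cases
    case 1
    then obtain x where x: "V = {x}" by (auto simp: card_1_singleton_iff)
    have "E = {}"
    proof (rule ccontr)
      assume "E \<noteq> {}"
      then obtain e where "e \<subseteq> {x}" "card e = 2" using E2 x by blast
      then show False using card_mono[of "{x}" e] by simp
    qed
    moreover have "rainbow_connected V E (\<lambda>_. 0)"
      using rpath_singleton[of x "{x}"] x by (auto simp: rainbow_connected_iff)
    \<comment> \<open>Without edges the colour bound is vacuous, so even the empty forest
      suffices.\<close>
    ultimately show ?thesis using induced_forest_empty by auto
  next
    case (2 x)
    have "{x} \<noteq> V" using 2 by auto
    then obtain y where y: "y \<in> V" "y \<noteq> x" "{x, y} \<in> E"
      using cut_connectedD[OF con, of "{x}"] 2(2) by auto
    let ?V = "V - {x}" and ?E = "{e\<in>E. x \<notin> e}"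
    have pend: "a = y" if "{x, a} \<in> E" for a using 2(3)[OF that y(3)] .
    have "card ?V < card V" using 2(2) fin by (rule card_Diff1_less[rotated])
    moreover have "simple_graph ?V ?E" using G by (auto simp: simple_graph_def)
    moreover have "cut_connected ?V ?E"
      by (rule cut_connected_remove_pendant[OF con y(1,2) pend])
    ultimately obtain S c where S: "induced_forest ?V ?E S"
      and c: "\<forall>e\<in>?E. c e < card S + 1" and rc: "rainbow_connected ?V ?E c"
      using less.hyps by blast
    have xS: "x \<notin> S" and SV: "S \<subseteq> V" using S by (auto simp: induced_forest_def)
    have "induced_edges ?E S = induced_edges E S" using xS by (auto simp: induced_edges_def)
    then have "induced_forest V E S" using S by (auto simp: induced_forest_def)
    then have fo: "induced_forest V E (insert x S)"
      by (rule induced_forest_insert) (use 2 E2 in auto)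
    \<comment> \<open>Old colours are at most \<open>card S\<close>, so \<open>card S + 1\<close> is
      new.\<close>
    have "rainbow_connected (insert x ?V) (insert {x, y} ?E) (c({x, y} := card S + 1))"
      by (rule rainbow_connected_insert[OF rc]) (use y c E2 in auto)
    moreover have "insert x ?V = V" using 2 by auto
    moreover have "insert {x, y} ?E = E"
    proof -
      have "e = {x, y}" if e: "e \<in> E" "x \<in> e" for e
      proof -
        obtain z where "e = {x, z}"
          using E2[OF e(1)] e(2) by (auto simp: card_2_iff insert_commute)
        then show ?thesis using pend[of z] e(1) by simp
      qed
      then show ?thesis using y by blast
    qed
    ultimately have rc': "rainbow_connected V E (c({x, y} := card S + 1))" by simp
    have "card (insert x S) = card S + 1" using xS SV fin by (simp add: finite_subset)
    moreover have "(c({x, y} := card S + 1)) e < card S + 2" if "e \<in> E" for e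
    proof (cases "e = {x, y}")
      case False
      then have "e \<in> ?E" using that \<open>insert {x, y} ?E = E\<close> by blast
      then have "c e < card S + 1" using c by blast
      then show ?thesis using False by (simp add: less_SucI)
    qed simp
    ultimately have "\<forall>e\<in>E. (c({x, y} := card S + 1)) e < card (insert x S) + 1" by simp
    then show ?thesis using fo rc' by blast
  next
    case 3
    obtain D S F c where st: "greedy_state V E D S F c" and dom: "closed_nbh V E D = V"
      using ex_dominating_greedy_state[OF G con 3(1)] by blast
    have D: "D \<subseteq> V" "D \<noteq> {}" and fo: "induced_forest V E S" and cS: "card S = card D + 1"
      and F: "F \<subseteq> E" "\<forall>e\<in>F. e \<subseteq> D \<and> c e + 1 < card D" and rc: "rainbow_connected D F c"
      using st unfolding greedy_state_def by blast+
    have "\<forall>e\<in>F. e \<subseteq> D \<and> c e < card D - 1" using F(2) by auto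
    from rainbow_connected_dominating[OF G D(1) dom F(1) this rc 3(2)]
    obtain c' where c': "\<forall>e\<in>E. c' e < card D - 1 + 3" "rainbow_connected V E c'" by blast
    have "card D > 0" using D fin by (simp add: card_gt_0_iff finite_subset)
    \<comment> \<open>The \<open>card D - 1\<close> tree colours and three more make
      \<open>card D + 2\<close>; positivity of \<open>card D\<close> makes the subtraction
      exact.\<close>
    then have "card D - 1 + 3 = card S + 1" using cS by simp
    then show ?thesis using c' fo by metis
  qed
qed

theorem theorem1:
  fixes V :: "'a set" and E :: "'a set set"
  assumes "connected_graph V E"
  shows "rc V E \<le> forest_number V E + 2"
proof -
  have G: "simple_graph V E" using assms by (simp add: connected_graph_def)
  obtain S c where S: "induced_forest V E S" and c: "\<forall>e\<in>E. c e < card S + 1"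
    "rainbow_connected V E c"
    using ex_forest_colouring[OF G connected_graph_imp_cut_connected[OF assms]] by blast
  have "finite V" using G by (simp add: simple_graph_def)
  then have "finite {S. induced_forest V E S}"
    by (rule finite_subset[rotated, OF finite_Pow_iff[THEN iffD2]]) (auto simp: induced_forest_def)
  then have "finite {card S | S. induced_forest V E S}" by simp
  then have "card S \<le> forest_number V E"
    unfolding forest_number_def using S by (intro Max_ge) auto
  \<comment> \<open>This in fact bounds \<open>rc V E\<close> by
    \<open>forest_number V E + 1\<close>.\<close>
  moreover have "rc V E \<le> card S + 1"
    unfolding rc_def by (rule Least_le) (use c in blast)
  ultimately show ?thesis by linarith
qed

end
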